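(* For every integer $k \geq 0$, there exists a 2-layer $k$-planar graph whose pathwidth is exactly $k+1$.
   Context: Let $G=(X\cup Y,E)$ be a bipartite graph with bipartition $(X,Y)$, $n_X=|X|$, $n_Y=|Y|$. A 2-layer drawing of $G$ is a pair $\pi=(\pi_X,\pi_Y)$ of bijections $\pi_X\colon X\to\{1,\dots,n_X\}$ and $\pi_Y\colon Y\to\{1,\dots,n_Y\}$. In $\pi$, an edge $\{x_1,y_1\}$ (with $x_1\in X$, $y_1\in Y$) crosses an edge $\{x_2,y_2\}$ (with $x_2\in X$, $y_2\in Y$) iff either $\pi_X(x_1)<\pi_X(x_2)$ and $\pi_Y(y_1)>\pi_Y(y_2)$, or $\pi_X(x_1)>\pi_X(x_2)$ and $\pi_Y(y_1)<\pi_Y(y_2)$. The drawing is 2-layer $k$-planar if every edge crosses at most $k$ edges. A graph is 2-layer $k$-planar if it has a bipartition $(X,Y)$ with a 2-layer $k$-planar drawing. Pathwidth is the usual minimum width (maximum bag size minus one) over path decompositions. *)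

theory Defs
  imports Main
begin

definition fin_graph :: "'a set \<Rightarrow> 'a set set \<Rightarrow> bool" where
  "fin_graph V E \<longleftrightarrow> finite V \<and> (\<forall>e\<in>E. e \<subseteq> V \<and> card e = 2)"

definition bipartition :: "'a set \<Rightarrow> 'a set set \<Rightarrow> 'a set \<Rightarrow> 'a set \<Rightarrow> bool" where
  "bipartition V E X Y \<longleftrightarrow>
     X \<union> Y = V \<and> X \<inter> Y = {} \<and> (\<forall>e\<in>E. \<exists>x\<in>X. \<exists>y\<in>Y. e = {x, y})"

definition two_layer_drawing ::
  "'a set \<Rightarrow> 'a set \<Rightarrow> ('a \<Rightarrow> nat) \<Rightarrow> ('a \<Rightarrow> nat) \<Rightarrow> bool" where
  "two_layer_drawing X Y \<pi>\<^sub>X \<pi>\<^sub>Y \<longleftrightarrow>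
     bij_betw \<pi>\<^sub>X X {1..card X} \<and> bij_betw \<pi>\<^sub>Y Y {1..card Y}"

definition crosses ::
  "'a set \<Rightarrow> 'a set \<Rightarrow> ('a \<Rightarrow> nat) \<Rightarrow> ('a \<Rightarrow> nat) \<Rightarrow> 'a set \<Rightarrow> 'a set \<Rightarrow> bool" where
  "crosses X Y \<pi>\<^sub>X \<pi>\<^sub>Y e f \<longleftrightarrow>
     (\<exists>x\<^sub>1\<in>X. \<exists>y\<^sub>1\<in>Y. \<exists>x\<^sub>2\<in>X. \<exists>y\<^sub>2\<in>Y. e = {x\<^sub>1, y\<^sub>1} \<and> f = {x\<^sub>2, y\<^sub>2} \<and>
        (\<pi>\<^sub>X x\<^sub>1 < \<pi>\<^sub>X x\<^sub>2 \<and> \<pi>\<^sub>Y y\<^sub>1 > \<pi>\<^sub>Y y\<^sub>2 \<or> \<pi>\<^sub>X x\<^sub>1 > \<pi>\<^sub>X x\<^sub>2 \<and> \<pi>\<^sub>Y y\<^sub>1 < \<pi>\<^sub>Y y\<^sub>2))"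

definition k_planar_drawing ::
  "nat \<Rightarrow> 'a set set \<Rightarrow> 'a set \<Rightarrow> 'a set \<Rightarrow> ('a \<Rightarrow> nat) \<Rightarrow> ('a \<Rightarrow> nat) \<Rightarrow> bool" where
  "k_planar_drawing k E X Y \<pi>\<^sub>X \<pi>\<^sub>Y \<longleftrightarrow>
     two_layer_drawing X Y \<pi>\<^sub>X \<pi>\<^sub>Y \<and> (\<forall>e\<in>E. card {f\<in>E. crosses X Y \<pi>\<^sub>X \<pi>\<^sub>Y e f} \<le> k)"

definition two_layer_k_planar :: "nat \<Rightarrow> 'a set \<Rightarrow> 'a set set \<Rightarrow> bool" where
  "two_layer_k_planar k V E \<longleftrightarrow>
     (\<exists>X Y \<pi>\<^sub>X \<pi>\<^sub>Y. bipartition V E X Y \<and> k_planar_drawing k E X Y \<pi>\<^sub>X \<pi>\<^sub>Y)"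

text \<open>A path decomposition is the list of its bags, in the order of the underlying path.\<close>

definition path_decomposition :: "'a set \<Rightarrow> 'a set set \<Rightarrow> 'a set list \<Rightarrow> bool" where
  "path_decomposition V E Bs \<longleftrightarrow>
     Bs \<noteq> [] \<and> \<Union>(set Bs) = V \<and> (\<forall>e\<in>E. \<exists>B\<in>set Bs. e \<subseteq> B) \<and>
     (\<forall>h i j. h \<le> i \<and> i \<le> j \<and> j < length Bs \<longrightarrow> Bs ! h \<inter> Bs ! j \<subseteq> Bs ! i)"

text \<open>Widths are integers because the graph without vertices has pathwidth \<open>-1\<close>.\<close>

definition width :: "'a set list \<Rightarrow> int" where
  "width Bs = int (Max (card ` set Bs)) - 1"

definition pathwidth :: "'a set \<Rightarrow> 'a set set \<Rightarrow> int" where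
  "pathwidth V E = (LEAST w. \<exists>Bs. path_decomposition V E Bs \<and> width Bs = w)"

end

theory Submission imports Defs "HOL-Library.Disjoint_Sets" begin

text \<open>Number the positions of both layers from left to right and draw all vertical edges
  \<open>x\<^sub>n y\<^sub>n\<close>. All other edges lead from \<open>x\<^sub>n\<close> to \<open>y\<^sub>n\<^sub>+\<^sub>k\<close> or \<open>y\<^sub>n\<^sub>+\<^sub>k\<^sub>+\<^sub>1\<close>: they do not cross one another,
  each passes over at most \<open>k\<close> vertical edges, and a sweep through the positions gives width \<open>k + 1\<close>.
  Jumping over \<open>k\<close> regular positions at a time yields \<open>k\<close> disjoint strands with only \<open>k - 1\<close> crossings
  per edge. The remaining crossing is spent on widely spaced special positions \<open>t\<close>, whose vertical
  edge, joined to \<open>x\<^sub>t\<^sub>-\<^sub>k\<close> and \<open>y\<^sub>t\<^sub>+\<^sub>k\<close>, is the middle of a path of length 3 (a rung) between two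
  cyclically consecutive strands.

  For the lower bound take three disjoint blocks, each so long that by Helly's theorem some bag meets
  all strands inside the block. Consider a rung in the block whose bag is the middle one. If a bag
  containing the middle edge of the rung lies between the outer two bags, it meets all \<open>k\<close> strands as well.
  Otherwise one of the outer bags separates it from the middle bag; besides the \<open>k\<close> strands in its own
  block it meets the two disjoint connected sets formed by one half of the rung and its strand.\<close>

section \<open>Linked vertex sets and path decompositions\<close>

definition touch :: "'a set set \<Rightarrow> 'a set \<Rightarrow> 'a set \<Rightarrow> bool" where
  "touch E C D \<longleftrightarrow> (\<exists>u\<in>C. \<exists>v\<in>D. u = v \<or> {u, v} \<in> E)"

text \<open>These are nonempty connected vertex sets, generated by merging touching ones. No paths
  are mentioned, and the induction rule is the shape that \<open>linked_gapless\<close>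
  needs.\<close>

inductive linked :: "'a set \<Rightarrow> 'a set set \<Rightarrow> 'a set \<Rightarrow> bool" for V E where
  linked_single: "v \<in> V \<Longrightarrow> linked V E {v}"
| linked_Un: "linked V E C \<Longrightarrow> linked V E D \<Longrightarrow> touch E C D \<Longrightarrow> linked V E (C \<union> D)"

lemma touch_mono: "touch E C D \<Longrightarrow> C \<subseteq> C' \<Longrightarrow> D \<subseteq> D' \<Longrightarrow> touch E C' D'"
  unfolding touch_def by blast

lemma touch_common: "v \<in> C \<Longrightarrow> v \<in> D \<Longrightarrow> touch E C D"
  unfolding touch_def by blast

lemma touch_edge: "u \<in> C \<Longrightarrow> v \<in> D \<Longrightarrow> {u, v} \<in> E \<Longrightarrow> touch E C D"
  unfolding touch_def by blast

lemma touch_sym: "touch E C D \<Longrightarrow> touch E D C"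
  unfolding touch_def by (metis insert_commute)

lemma linked_chain:
  assumes "a < b"
    and "\<And>l. a \<le> l \<Longrightarrow> l < b \<Longrightarrow> linked V E (f l)"
    and "\<And>l. a \<le> l \<Longrightarrow> Suc l < b \<Longrightarrow> touch E (f l) (f (Suc l))"
  shows "linked V E (\<Union>l\<in>{a..<b}. f l)"
  using assms
proof (induction b)
  case (Suc b)
  show ?case
  proof (cases "a = b")
    case True
    then show ?thesis using Suc.prems by simp
  next
    case False
    then have ab: "a < b" using Suc.prems by simp
    have l: "linked V E (\<Union>l\<in>{a..<b}. f l)"
      using Suc.IH Suc.prems ab by simp
    have "touch E (f (b - 1)) (f b)"
      using Suc.prems(3)[of "b - 1"] ab by simp
    moreover have "f (b - 1) \<subseteq> (\<Union>l\<in>{a..<b}. f l)"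
      using ab by (intro UN_upper) auto
    ultimately have "touch E (\<Union>l\<in>{a..<b}. f l) (f b)"
      by (rule touch_mono) simp
    then have "linked V E ((\<Union>l\<in>{a..<b}. f l) \<union> f b)"
      using l Suc.prems by (intro linked_Un) auto
    moreover have "(\<Union>l\<in>{a..<Suc b}. f l) = (\<Union>l\<in>{a..<b}. f l) \<union> f b"
      using ab by (simp add: atLeastLessThanSuc Un_commute)
    ultimately show ?thesis by simp
  qed
qed simp

section \<open>Connected sets meet contiguous runs of bags\<close>

lemma path_decomposition_Union: "path_decomposition V E Bs \<Longrightarrow> \<Union> (set Bs) = V"
  by (simp add: path_decomposition_def)

lemma path_decomposition_edge: "path_decomposition V E Bs \<Longrightarrow> {u, v} \<in> E \<Longrightarrow> \<exists>B\<in>set Bs. u \<in> B \<and> v \<in> B"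
  unfolding path_decomposition_def by (metis insert_subset)

lemma path_decomposition_between:
  "path_decomposition V E Bs \<Longrightarrow> a \<le> b \<Longrightarrow> b \<le> c \<Longrightarrow> c < length Bs \<Longrightarrow> Bs ! a \<inter> Bs ! c \<subseteq> Bs ! b"
  by (simp add: path_decomposition_def)

definition hits :: "'a set list \<Rightarrow> 'a set \<Rightarrow> nat set" where
  "hits Bs C = {j. j < length Bs \<and> Bs ! j \<inter> C \<noteq> {}}"

definition gapless :: "nat set \<Rightarrow> bool" where
  "gapless S \<longleftrightarrow> (\<forall>a\<in>S. \<forall>c\<in>S. {a..c} \<subseteq> S)"

lemma gaplessD: "gapless S \<Longrightarrow> a \<in> S \<Longrightarrow> c \<in> S \<Longrightarrow> a \<le> b \<Longrightarrow> b \<le> c \<Longrightarrow> b \<in> S"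
  unfolding gapless_def by (meson atLeastAtMost_iff subsetD)

lemma gapless_Un:
  assumes S: "gapless S" and T: "gapless T" and d: "d \<in> S" "d \<in> T"
  shows "gapless (S \<union> T)"
  unfolding gapless_def
proof (intro ballI subsetI)
  fix a c b assume "a \<in> S \<union> T" "c \<in> S \<union> T" "b \<in> {a..c}"
  then show "b \<in> S \<union> T"
    using gaplessD[OF S, of a d b] gaplessD[OF S, of d c b] gaplessD[OF S, of a c b]
      gaplessD[OF T, of a d b] gaplessD[OF T, of d c b] gaplessD[OF T, of a c b] d
    by (cases "b \<le> d") auto
qed

lemma hits_Un: "hits Bs (C \<union> D) = hits Bs C \<union> hits Bs D"
  unfolding hits_def by auto

lemma hits_touch:
  assumes pd: "path_decomposition V E Bs" and "touch E C D" "C \<subseteq> V"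
  shows "hits Bs C \<inter> hits Bs D \<noteq> {}"
proof -
  obtain u v where uv: "u \<in> C" "v \<in> D" "u = v \<or> {u, v} \<in> E"
    using assms unfolding touch_def by blast
  have "\<exists>B\<in>set Bs. u \<in> B \<and> v \<in> B"
    using uv(3)
  proof
    assume "u = v"
    moreover have "u \<in> \<Union> (set Bs)"
      using uv(1) \<open>C \<subseteq> V\<close> path_decomposition_Union[OF pd] by blast
    ultimately show ?thesis by blast
  next
    assume "{u, v} \<in> E"
    then show ?thesis using path_decomposition_edge[OF pd] by blast
  qed
  then obtain j where "j < length Bs" "u \<in> Bs ! j" "v \<in> Bs ! j"
    by (metis in_set_conv_nth)
  then show ?thesis using uv unfolding hits_def by blast
qed

lemma linked_subset: "linked V E C \<Longrightarrow> C \<subseteq> V"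
  by (induction rule: linked.induct) auto

text \<open>A single vertex occupies an interval of bags by the definition of a path decomposition.
  Two touching sets share a bag, so merging them unites two overlapping intervals.\<close>

lemma linked_gapless:
  assumes pd: "path_decomposition V E Bs" and "linked V E C"
  shows "gapless (hits Bs C)"
  using assms(2)
proof induction
  case (linked_single v)
  show ?case unfolding gapless_def
  proof (intro ballI subsetI)
    fix a c b assume "a \<in> hits Bs {v}" "c \<in> hits Bs {v}" "b \<in> {a..c}"
    moreover from this have "Bs ! a \<inter> Bs ! c \<subseteq> Bs ! b"
      using path_decomposition_between[OF pd, of a b c] by (simp add: hits_def)
    ultimately show "b \<in> hits Bs {v}" by (auto simp: hits_def)
  qed
next
  case (linked_Un C D)
  have "hits Bs C \<inter> hits Bs D \<noteq> {}"
    by (rule hits_touch[OF pd linked_Un.hyps(3) linked_subset[OF linked_Un.hyps(1)]])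
  then obtain d where "d \<in> hits Bs C" "d \<in> hits Bs D" by blast
  then show ?case
    unfolding hits_Un by (rule gapless_Un[OF linked_Un.IH])
qed

text \<open>Helly's theorem on a line: the largest of the left end points lies in all sets.\<close>

lemma common_bag:
  assumes pd: "path_decomposition V E Bs" and I: "finite I" "I \<noteq> {}"
    and L: "\<And>i. i \<in> I \<Longrightarrow> linked V E (F i)"
    and T: "\<And>i j. i \<in> I \<Longrightarrow> j \<in> I \<Longrightarrow> touch E (F i) (F j)"
  shows "\<exists>b<length Bs. \<forall>i\<in>I. Bs ! b \<inter> F i \<noteq> {}"
proof -
  define lo where "lo i = (LEAST j. j \<in> hits Bs (F i))" for i
  have meet: "hits Bs (F i) \<inter> hits Bs (F j) \<noteq> {}" if "i \<in> I" "j \<in> I" for i j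
    using hits_touch[OF pd T[OF that] linked_subset[OF L[OF that(1)]]] .
  have lo: "lo i \<in> hits Bs (F i)" if "i \<in> I" for i
    using meet[OF that that] unfolding lo_def by (auto intro: LeastI)
  have lo_le: "lo i \<le> c" if "c \<in> hits Bs (F i)" for i c
    using that unfolding lo_def by (rule Least_le)
  define b where "b = Max (lo ` I)"
  have "b \<in> lo ` I" unfolding b_def using I by (intro Max_in) auto
  then obtain i0 where i0: "i0 \<in> I" "b = lo i0" by blast
  have all: "b \<in> hits Bs (F i)" if i: "i \<in> I" for i
  proof -
    obtain c where c: "c \<in> hits Bs (F i0)" "c \<in> hits Bs (F i)"
      using meet[OF i0(1) i] by blast
    have "lo i \<le> b" unfolding b_def using I i by auto
    moreover have "b \<le> c" using lo_le[OF c(1)] i0 by simp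
    ultimately show ?thesis
      using gaplessD[OF linked_gapless[OF pd L[OF i]] lo[OF i] c(2)] by blast
  qed
  then show ?thesis using I unfolding hits_def by blast
qed

lemma card_hit_disjoint:
  assumes "finite B" "finite I" "disjoint_family_on F I" "\<And>i. i \<in> I \<Longrightarrow> B \<inter> F i \<noteq> {}"
  shows "card I \<le> card B"
proof -
  define f where "f i = (SOME v. v \<in> B \<inter> F i)" for i
  have f: "f i \<in> B \<inter> F i" if "i \<in> I" for i
    unfolding f_def using assms(4)[OF that] by (rule some_in_eq[THEN iffD2])
  have "inj_on f I"
  proof (rule inj_onI)
    fix i j assume "i \<in> I" "j \<in> I" "f i = f j"
    then have "f i \<in> F i \<inter> F j" using f by fastforce
    then show "i = j"
      using assms(3) \<open>i \<in> I\<close> \<open>j \<in> I\<close> unfolding disjoint_family_on_def by blast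
  qed
  moreover have "f ` I \<subseteq> B" using f by blast
  ultimately show ?thesis using assms(1) card_inj_on_le by blast
qed

lemma finite_bag: "path_decomposition V E Bs \<Longrightarrow> finite V \<Longrightarrow> j < length Bs \<Longrightarrow> finite (Bs ! j)"
  by (metis Union_upper finite_subset nth_mem path_decomposition_Union)

text \<open>The sets \<open>F i\<close> are the branch sets of a clique minor. This settles
  \<open>k = 0\<close> and \<open>k = 1\<close> in \<open>G_large_bag\<close>.\<close>

lemma clique_minor_bag:
  assumes pd: "path_decomposition V E Bs" and "finite V" and I: "finite I" "I \<noteq> {}"
    and "disjoint_family_on F I"
    and L: "\<And>i. i \<in> I \<Longrightarrow> linked V E (F i)"
    and T: "\<And>i j. i \<in> I \<Longrightarrow> j \<in> I \<Longrightarrow> touch E (F i) (F j)"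
  shows "\<exists>B\<in>set Bs. card I \<le> card B"
proof -
  obtain b where b: "b < length Bs" "\<forall>i\<in>I. Bs ! b \<inter> F i \<noteq> {}"
    using common_bag[OF pd I, of F] L T by blast
  then have "card I \<le> card (Bs ! b)"
    using card_hit_disjoint[OF finite_bag[OF pd \<open>finite V\<close> b(1)] I(1) assms(5)] by blast
  then show ?thesis using b(1) by (meson nth_mem)
qed

lemma pathwidth_eqI:
  assumes "path_decomposition V E Bs" "\<And>B. B \<in> set Bs \<Longrightarrow> card B \<le> Suc w"
    and lower: "\<And>Bs. path_decomposition V E Bs \<Longrightarrow> \<exists>B\<in>set Bs. Suc w \<le> card B"
  shows "pathwidth V E = int w"
proof -
  have ge: "int w \<le> width Bs'" if pd: "path_decomposition V E Bs'" for Bs'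
  proof -
    obtain B where "B \<in> set Bs'" "Suc w \<le> card B" using lower[OF pd] by blast
    then have "Suc w \<le> Max (card ` set Bs')"
      by (meson List.finite_set Max_ge finite_imageI image_eqI le_trans)
    then show ?thesis unfolding width_def by simp
  qed
  have "Bs \<noteq> []" using assms(1) unfolding path_decomposition_def by simp
  then have "Max (card ` set Bs) \<le> Suc w" using assms(2) by simp
  then have "width Bs = int w" using ge[OF assms(1)] unfolding width_def by simp
  then show ?thesis
    unfolding pathwidth_def using assms(1) ge by (intro Least_equality) auto
qed

section \<open>The graph\<close>

text \<open>Enumerates the numbers that are not multiples of \<open>2 * k + 2\<close>.\<close>

definition rho :: "nat \<Rightarrow> nat \<Rightarrow> nat" where
  "rho k g = Suc (g + g div (2 * k + 1))"

text \<open>The upper vertices \<open>x\<^sub>n\<close> and the lower vertices \<open>y\<^sub>n\<close> are encoded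
  as \<open>2 * n\<close> and \<open>2 * n + 1\<close>, and \<open>arc k n m\<close> stands for the edge \<open>x\<^sub>n y\<^sub>m\<close>.\<close>

inductive arc :: "nat \<Rightarrow> nat \<Rightarrow> nat \<Rightarrow> bool" for k where
  arc_vertical: "arc k n n"
| arc_strand: "arc k (rho k g) (rho k (g + k))"
| arc_fork: "arc k ((2 * k + 2) * Suc q - k) ((2 * k + 2) * Suc q)"
| arc_merge: "arc k ((2 * k + 2) * Suc q) ((2 * k + 2) * Suc q + k)"

definition G_verts :: "nat \<Rightarrow> nat set" where
  "G_verts N = {..<2 * N}"

text \<open>Bounding \<open>m\<close> alone keeps both ends inside \<open>G_verts N\<close>, because
  \<open>n \<le> m\<close> for every arc by \<open>arc_length\<close>.\<close>

definition G_edges :: "nat \<Rightarrow> nat \<Rightarrow> nat set set" where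
  "G_edges k N = {{2 * n, 2 * m + 1} | n m. arc k n m \<and> m < N}"

section \<open>Arithmetic of regular positions and multiples of \<open>2 * k + 2\<close>\<close>

text \<open>Since \<open>k < 2 * k + 1\<close>, a jump over \<open>k\<close> regular indices skips
  at most one multiple of \<open>2 * k + 2\<close>.\<close>

lemma rho_add_le: "rho k (g + k) \<le> rho k g + k + 1"
proof -
  have "(g + k) div (2 * k + 1) \<le> (g + (2 * k + 1)) div (2 * k + 1)"
    by (rule div_le_mono) simp
  also have "\<dots> = Suc (g div (2 * k + 1))" by (subst div_add_self2) auto
  finally show ?thesis unfolding rho_def by simp
qed

lemma rho_add_ge: "rho k g + j \<le> rho k (g + j)"
  unfolding rho_def by (simp add: div_le_mono)

lemma rho_less_iff: "rho k g < rho k h \<longleftrightarrow> g < h"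
proof -
  have *: "rho k a < rho k b" if "a < b" for a b
    using rho_add_ge[of k a "b - a"] that by simp
  show ?thesis by (metis * less_asym less_irrefl linorder_neqE_nat)
qed

lemma rho_eq_iff: "rho k g = rho k h \<longleftrightarrow> g = h"
  by (metis rho_less_iff less_irrefl linorder_neqE_nat)

lemma rho_mult_add:
  assumes "r < 2 * k + 1"
  shows "rho k ((2 * k + 1) * q + r) = (2 * k + 2) * q + Suc r"
proof -
  have "((2 * k + 1) * q + r) div (2 * k + 1) = q"
    using assms by (intro div_nat_eqI) auto
  then show ?thesis unfolding rho_def by (simp add: algebra_simps)
qed

text \<open>Each period of \<open>2 * k + 2\<close> positions holds \<open>2 * k + 1\<close> regular
  ones, so exactly \<open>(2 * k + 1) * q\<close> regular positions precede the multiple number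
  \<open>q\<close>.\<close>

lemma rho_less_mult: "rho k g < (2 * k + 2) * q \<longleftrightarrow> g < (2 * k + 1) * q"
proof -
  define m where "m = 2 * k + 1"
  define a r where "a = g div m" and "r = g mod m"
  have r: "r < m" unfolding r_def m_def by simp
  have g: "g = m * a + r" unfolding a_def r_def by simp
  have eq: "rho k g = Suc m * a + Suc r"
    using rho_mult_add[of r k a] r unfolding g m_def by simp
  show ?thesis
  proof (cases "a < q")
    case True
    then have "m * Suc a \<le> m * q" "Suc m * Suc a \<le> Suc m * q"
      by (intro mult_le_mono2; simp)+
    then show ?thesis using r eq g unfolding m_def by simp
  next
    case False
    then have "m * q \<le> m * a" "Suc m * q \<le> Suc m * a"
      by (intro mult_le_mono2; simp)+
    then show ?thesis using r eq g unfolding m_def by simp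
  qed
qed

lemma rho_neq_mult: "rho k g \<noteq> (2 * k + 2) * q"
proof
  assume eq: "rho k g = (2 * k + 2) * q"
  then have "\<not> g < (2 * k + 1) * q" using rho_less_mult[of k g q] by simp
  then have "rho k ((2 * k + 1) * q) \<le> rho k g"
    by (metis not_le rho_less_iff)
  then show False using eq rho_mult_add[of 0 k q] by simp
qed

lemma rho_or_mult:
  obtains q where "n = (2 * k + 2) * q" | h where "n = rho k h"
proof (cases "n mod (2 * k + 2) = 0")
  case True
  then show ?thesis using that(1) by (metis mod_0_imp_dvd dvdE)
next
  case False
  define q r where "q = n div (2 * k + 2)" and "r = n mod (2 * k + 2) - 1"
  have "n mod (2 * k + 2) < 2 * k + 2" by simp
  then have "r < 2 * k + 1" "n mod (2 * k + 2) = Suc r" using False unfolding r_def by linarith+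
  moreover have "n = (2 * k + 2) * q + n mod (2 * k + 2)" unfolding q_def by (rule mult_div_mod_eq[symmetric])
  ultimately show ?thesis using that(2) rho_mult_add by metis
qed

text \<open>The far ends of a rung are regular positions. Modulo \<open>k\<close>, the index here is
  congruent to the number of the multiple and the one in \<open>rho_merge\<close> to one less, so a
  rung joins cyclically consecutive strands.\<close>

lemma rho_fork: "0 < k \<Longrightarrow> rho k ((2 * k + 1) * Suc q - k) = (2 * k + 2) * Suc q - k"
  using rho_mult_add[of "k + 1" k q] rho_mult_add[of 0 k "Suc q"]
  by (simp add: algebra_simps)

lemma rho_merge: "0 < k \<Longrightarrow> rho k ((2 * k + 1) * q + (k - 1)) = (2 * k + 2) * q + k"
  using rho_mult_add[of "k - 1" k q] by simp

section \<open>Lengths of arcs and crossing counts\<close>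

lemma arc_length:
  assumes "arc k n m"
  shows "n \<le> m \<and> m \<le> n + k + 1 \<and> (n = m \<or> n + k \<le> m)"
  using assms
proof cases
  case (arc_strand g)
  then show ?thesis using rho_add_le[of k g] rho_add_ge[of k g k] by simp
qed auto

text \<open>Modulo \<open>2 * k + 2\<close>, a merge edge passes over the residues from 1 to
  \<open>k - 1\<close> only, and a fork edge over residues above \<open>k + 2\<close> only. Hence at
  most one rung edge passes over \<open>p\<close>, and the residue of \<open>p\<close> tells
  which.\<close>

lemma rung_over_unique:
  assumes "arc k n m" "n < p" "p < m" "\<And>g. (n, m) \<noteq> (rho k g, rho k (g + k))"
  defines "M \<equiv> 2 * k + 2"
  defines "q \<equiv> p div M"
  shows "(n, m) = (if p mod M < k then (M * q, M * q + k) else (M * Suc q - k, M * Suc q))"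
  using assms(1)
proof cases
  case (arc_fork q')
  define r where "r = p - M * q'"
  have "M * q' + r = p" "k \<le> r" "r < M"
    using assms(2,3) arc_fork unfolding r_def M_def by auto
  moreover from this have "p div M = q'" "p mod M = r"
    by (auto intro: div_nat_eqI simp: mod_nat_eqI)
  ultimately show ?thesis using arc_fork unfolding q_def M_def by simp
next
  case (arc_merge q')
  define r where "r = p - M * Suc q'"
  have "M * Suc q' + r = p" "r < k" "r < M"
    using assms(2,3) arc_merge unfolding r_def M_def by auto
  moreover from this have "p div M = Suc q'" "p mod M = r"
    by (auto intro: div_nat_eqI simp: mod_nat_eqI)
  ultimately show ?thesis using arc_merge unfolding q_def M_def by simp
qed (use assms in auto)

text \<open>Over a multiple of \<open>2 * k + 2\<close> pass at most \<open>k\<close> strand edges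
  and no rung edge. Over a regular position pass at most \<open>k - 1\<close> strand edges, which
  leaves room for one rung edge.\<close>

lemma card_arcs_over:
  "finite {(n, m). arc k n m \<and> n < p \<and> p < m} \<and> card {(n, m). arc k n m \<and> n < p \<and> p < m} \<le> k"
  (is "finite ?A \<and> card ?A \<le> k")
proof -
  let ?f = "\<lambda>g. (rho k g, rho k (g + k))"
  have bound: ?thesis if "?A \<subseteq> S" "finite S" "card S \<le> k" for S
    using that by (meson card_mono finite_subset le_trans)
  show ?thesis
  proof (cases "k = 0")
    case True
    have "False" if "arc k n m" "n < p" "p < m" for n m
      using arc_length[OF that(1)] that(2,3) True by linarith
    then have "?A = {}" by blast
    then show ?thesis by (simp only: card.empty finite.emptyI) simp
  next
    case False
    show ?thesis
    proof (rule rho_or_mult[of p k])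
      fix q assume p: "p = (2 * k + 2) * q"
      have "?A \<subseteq> ?f ` {(2 * k + 1) * q - k..<(2 * k + 1) * q}"
      proof clarify
        fix n m assume nm: "arc k n m" "n < p" "p < m"
        have "\<exists>g. (n, m) = ?f g"
        proof (rule ccontr)
          assume "\<not> ?thesis"
          moreover have "p div (2 * k + 2) = q" "p mod (2 * k + 2) = 0"
            unfolding p by (rule nonzero_mult_div_cancel_left, simp) (rule mod_mult_self1_is_0)
          \<comment> \<open>Residue 0 selects the merge edge that starts at \<open>p\<close> and so
            does not pass over it.\<close>
          ultimately have "(n, m) = ((2 * k + 2) * q, (2 * k + 2) * q + k)"
            using rung_over_unique[OF nm] False by auto
          then show False using nm(2) p by (metis Pair_inject less_irrefl)
        qed
        then obtain g where g: "n = rho k g" "m = rho k (g + k)" by blast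
        have "g < (2 * k + 1) * q" using nm(2) g p rho_less_mult by blast
        moreover have "\<not> g + k < (2 * k + 1) * q"
          using nm(3) g p rho_less_mult[of k "g + k" q] by linarith
        ultimately show "(n, m) \<in> ?f ` {(2 * k + 1) * q - k..<(2 * k + 1) * q}"
          using g by auto
      qed
      then show ?thesis
        by (rule bound) (auto intro: le_trans[OF card_image_le])
    next
      fix h assume p: "p = rho k h"
      \<comment> \<open>The only candidate that \<open>rung_over_unique\<close> leaves for a rung
        edge over \<open>p\<close>.\<close>
      define z where "z = (let M = 2 * k + 2; q = p div M in
        if p mod M < k then (M * q, M * q + k) else (M * Suc q - k, M * Suc q))"
      have "?A \<subseteq> insert z (?f ` {Suc h - k..<h})"
      proof clarify
        fix n m assume nm: "arc k n m" "n < p" "p < m" and im: "(n, m) \<notin> ?f ` {Suc h - k..<h}"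
        have "(n, m) \<noteq> ?f g" for g
        proof
          assume g: "(n, m) = ?f g"
          then have "g < h" "h < g + k" using nm p rho_less_iff by simp_all
          then show False using im g by auto
        qed
        then show "(n, m) = z" using rung_over_unique[OF nm] unfolding z_def Let_def by blast
      qed
      moreover have "card (insert z (?f ` {Suc h - k..<h})) \<le> Suc (card (?f ` {Suc h - k..<h}))"
        by (rule card_insert_le_m1) auto
      moreover have "card (?f ` {Suc h - k..<h}) \<le> k - 1"
        by (rule le_trans[OF card_image_le]) auto
      ultimately show ?thesis using False by (intro bound) auto
    qed
  qed
qed

text \<open>A vertical edge is crossed only by arcs that pass over it. The spans of other arcs are
  \<open>k\<close> or \<open>k + 1\<close>, so none lies strictly inside another on both layers;
  such an arc crosses only the at most \<open>k\<close> vertical edges strictly between its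
  ends.\<close>

lemma card_crossing_arcs:
  assumes "arc k n m"
  defines "A \<equiv> {(n', m'). arc k n' m' \<and> (n < n' \<and> m' < m \<or> n' < n \<and> m < m')}"
  shows "finite A \<and> card A \<le> k"
proof (cases "n = m")
  case True
  have "A = {(n', m'). arc k n' m' \<and> n' < n \<and> n < m'}"
    using arc_length unfolding A_def True by fastforce
  then show ?thesis using card_arcs_over by simp
next
  case False
  have len: "n + k \<le> m" "m \<le> n + k + 1" using arc_length[OF assms(1)] False by auto
  have "A \<subseteq> (\<lambda>j. (j, j)) ` {n<..<m}"
  proof
    fix a assume "a \<in> A"
    then obtain n' m' where a: "a = (n', m')" "arc k n' m'" "n < n' \<and> m' < m \<or> n' < n \<and> m < m'"
      unfolding A_def by blast
    show "a \<in> (\<lambda>j. (j, j)) ` {n<..<m}"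
      using arc_length[OF a(2)] a(1,3) len by auto
  qed
  moreover have "card ((\<lambda>j. (j, j)) ` {n<..<m}) \<le> k"
    by (rule le_trans[OF card_image_le]) (use len in auto)
  ultimately show ?thesis by (meson card_mono finite_greaterThanLessThan finite_imageI finite_subset le_trans)
qed

section \<open>The drawing and the upper bound\<close>

lemma fin_graph_G: "fin_graph (G_verts N) (G_edges k N)"
proof -
  have "card {2 * n, 2 * m + 1} = 2" for n m :: nat
    by (rule card_2_iff[THEN iffD2]) (metis dvd_triv_left even_plus_one_iff)
  moreover have "n < N" if "arc k n m" "m < N" for n m
    using arc_length[OF that(1)] that(2) by simp
  ultimately show ?thesis unfolding fin_graph_def G_verts_def G_edges_def by auto
qed

lemma two_layer_k_planar_G: "two_layer_k_planar k (G_verts N) (G_edges k N)"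
proof -
  define X Y where "X = (\<lambda>n. 2 * n) ` {..<N}" and "Y = (\<lambda>n. 2 * n + 1) ` {..<N}"
  \<comment> \<open>One map orders both layers by index; \<open>Suc\<close> makes the positions
    start at 1.\<close>
  define \<pi> where "\<pi> v = Suc (v div 2)" for v :: nat
  have "v \<in> X \<union> Y" if "v < 2 * N" for v
  proof (cases "even v")
    case True
    then show ?thesis using that unfolding X_def by (auto elim!: evenE)
  next
    case False
    then show ?thesis using that unfolding Y_def by (auto elim!: oddE)
  qed
  then have XY: "X \<union> Y = G_verts N" unfolding G_verts_def X_def Y_def by auto
  have disj: "X \<inter> Y = {}" unfolding X_def Y_def by (auto simp: image_iff) presburger
  have bip: "bipartition (G_verts N) (G_edges k N) X Y"
    unfolding bipartition_def
  proof (intro conjI ballI XY disj)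
    fix e assume "e \<in> G_edges k N"
    then obtain n m where "e = {2 * n, 2 * m + 1}" "arc k n m" "m < N"
      unfolding G_edges_def by blast
    moreover from this have "n < N" using arc_length by fastforce
    ultimately show "\<exists>x\<in>X. \<exists>y\<in>Y. e = {x, y}" unfolding X_def Y_def by blast
  qed
  have bij: "bij_betw \<pi> (f ` {..<N}) {1..card (f ` {..<N})}" if f: "\<And>n. f n div 2 = n" for f
  proof -
    have inj: "inj_on f {..<N}" by (metis f inj_onI)
    have "inj_on \<pi> (f ` {..<N})" using f unfolding \<pi>_def by (auto intro!: inj_onI)
    moreover have "\<pi> ` f ` {..<N} = {1..N}"
      unfolding \<pi>_def image_image f using image_Suc_lessThan by simp
    ultimately show ?thesis using card_image[OF inj] unfolding bij_betw_def by simp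
  qed
  have "two_layer_drawing X Y \<pi> \<pi>"
    unfolding two_layer_drawing_def X_def Y_def using bij by simp
  moreover have "card {f \<in> G_edges k N. crosses X Y \<pi> \<pi> e f} \<le> k" if eG: "e \<in> G_edges k N" for e
  proof -
    obtain n m where e: "e = {2 * n, 2 * m + 1}" "arc k n m"
      using eG unfolding G_edges_def by blast
    define A where "A = {(n', m'). arc k n' m' \<and> (n < n' \<and> m' < m \<or> n' < n \<and> m < m')}"
    \<comment> \<open>Parity tells the two ends of an edge apart, so the ends chosen by
      \<open>crosses\<close> are those given by \<open>arc\<close>.\<close>
    have eq: "a = a' \<and> b = b'" if "{2 * a, 2 * b + 1} = {2 * a', 2 * b' + 1}" for a b a' b' :: nat
      using that unfolding doubleton_eq_iff by presburger
    have "{f \<in> G_edges k N. crosses X Y \<pi> \<pi> e f} \<subseteq> (\<lambda>(n', m'). {2 * n', 2 * m' + 1}) ` A"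
    proof clarify
      fix f assume f: "f \<in> G_edges k N" and "crosses X Y \<pi> \<pi> e f"
      then obtain a b a' b' where ab: "e = {2 * a, 2 * b + 1}" "f = {2 * a', 2 * b' + 1}"
        "a < a' \<and> b' < b \<or> a' < a \<and> b < b'"
        unfolding crosses_def X_def Y_def \<pi>_def by auto
      obtain n' m' where nm': "f = {2 * n', 2 * m' + 1}" "arc k n' m'"
        using f unfolding G_edges_def by blast
      have "a = n" "b = m" "a' = n'" "b' = m'" using eq ab(1,2) e(1) nm'(1) by metis+
      then have "(n', m') \<in> A" using ab(3) nm'(2) unfolding A_def by simp
      then show "f \<in> (\<lambda>(n', m'). {2 * n', 2 * m' + 1}) ` A" using nm'(1) by force
    qed
    moreover have "finite A" "card A \<le> k" using card_crossing_arcs[OF e(2)] unfolding A_def by auto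
    ultimately show ?thesis by (meson card_image_le card_mono finite_imageI le_trans)
  qed
  ultimately have "k_planar_drawing k (G_edges k N) X Y \<pi> \<pi>"
    unfolding k_planar_drawing_def by blast
  then show ?thesis using bip unfolding two_layer_k_planar_def by blast
qed

text \<open>The bags sweep over the positions; each holds one lower vertex and a window of \<open>k + 1\<close> upper ones.\<close>

lemma path_decomposition_G:
  assumes "0 < N"
  shows "\<exists>Bs. path_decomposition (G_verts N) (G_edges k N) Bs \<and> (\<forall>B\<in>set Bs. card B \<le> k + 2)"
proof -
  define W where "W c = {i. i < N \<and> i < c \<and> c \<le> i + k + 1}" for c
  \<comment> \<open>Each lower vertex gets two consecutive bags. The window of the first reaches
    back \<open>k + 1\<close> positions, for the longest arcs; that of the second is shifted by one
    to include the upper vertex of the vertical edge.\<close>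
  define bag where "bag j = insert (2 * (j div 2) + 1) ((*) 2 ` W ((j + 1) div 2))" for j
  define Bs where "Bs = map bag [0..<2 * N]"
  have set_Bs: "set Bs = bag ` {..<2 * N}" unfolding Bs_def by auto
  have nth: "Bs ! j = bag j" if "j < 2 * N" for j using that unfolding Bs_def by simp
  have y: "2 * n + 1 \<in> bag j \<longleftrightarrow> j div 2 = n" for n j
  proof -
    have "2 * n + 1 \<noteq> 2 * i" for i by presburger
    then show ?thesis unfolding bag_def by auto
  qed
  have x: "2 * n \<in> bag j \<longleftrightarrow> n \<in> W ((j + 1) div 2)" for n j
  proof -
    have "2 * n \<noteq> 2 * i + 1" for i by presburger
    then show ?thesis unfolding bag_def by auto
  qed
  have "bag j \<subseteq> G_verts N" if "j < 2 * N" for j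
  proof -
    have "2 * (j div 2) + 1 < 2 * N" using that by presburger
    then show ?thesis unfolding bag_def W_def G_verts_def by auto
  qed
  moreover have "\<exists>j<2 * N. v \<in> bag j" if "v < 2 * N" for v
  proof (cases "even v")
    case True
    then obtain n where n: "v = 2 * n" by (elim evenE)
    then have "v \<in> bag (2 * n + 1)" using that x[of n "2 * n + 1"] unfolding W_def by simp
    then show ?thesis using that n by (intro exI[of _ "2 * n + 1"]) auto
  next
    case False
    then obtain n where n: "v = 2 * n + 1" by (elim oddE)
    then have "v \<in> bag v" using y[of n v] by simp
    then show ?thesis using that by blast
  qed
  ultimately have U: "\<Union> (set Bs) = G_verts N"
    unfolding set_Bs G_verts_def by (intro equalityI subsetI) (auto simp: Bex_def)
  have edge: "\<exists>B\<in>set Bs. e \<subseteq> B" if eG: "e \<in> G_edges k N" for e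
  proof -
    obtain n m where e: "e = {2 * n, 2 * m + 1}" "arc k n m" "m < N"
      using eG unfolding G_edges_def by blast
    define j where "j = (if n = m then 2 * m + 1 else 2 * m)"
    have "j < 2 * N" using e(3) unfolding j_def by auto
    moreover have "e \<subseteq> bag j"
      using x[of n j] y[of m j] arc_length[OF e(2)] e unfolding j_def W_def by auto
    ultimately show ?thesis unfolding set_Bs by blast
  qed
  have between: "Bs ! h \<inter> Bs ! j \<subseteq> Bs ! i" if "h \<le> i" "i \<le> j" "j < length Bs" for h i j
  proof
    fix v assume v: "v \<in> Bs ! h \<inter> Bs ! j"
    have "j < 2 * N" using that unfolding Bs_def by simp
    then have v': "v \<in> bag h" "v \<in> bag j" using v nth that by auto
    have "v \<in> bag i"
    proof (cases "even v")
      case True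
      then obtain n where n: "v = 2 * n" by (elim evenE)
      have "(h + 1) div 2 \<le> (i + 1) div 2" "(i + 1) div 2 \<le> (j + 1) div 2"
        using that by (auto intro: div_le_mono)
      then show ?thesis using v' x unfolding n W_def by auto
    next
      case False
      then obtain n where n: "v = 2 * n + 1" by (elim oddE)
      have "h div 2 \<le> i div 2" "i div 2 \<le> j div 2"
        using that by (auto intro: div_le_mono)
      then show ?thesis using v' y unfolding n by auto
    qed
    then show "v \<in> Bs ! i" using nth that \<open>j < 2 * N\<close> by simp
  qed
  have "card (bag j) \<le> k + 2" for j
  proof -
    define c where "c = (j + 1) div 2"
    have W: "W c \<subseteq> {c - (k + 1)..<c}" unfolding W_def by auto
    have "card ((*) 2 ` W c) \<le> card (W c)"
      using W by (intro card_image_le) (rule finite_subset, auto)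
    also have "\<dots> \<le> k + 1" using card_mono[OF _ W] by simp
    finally show ?thesis
      unfolding bag_def c_def[symmetric] using card_insert_le_m1[of "k + 2" "(*) 2 ` W c"] by simp
  qed
  moreover have "Bs \<noteq> []" using assms unfolding Bs_def by simp
  moreover from this have "path_decomposition (G_verts N) (G_edges k N) Bs"
    unfolding path_decomposition_def using U edge between by (intro conjI ballI allI impI) simp_all
  ultimately show ?thesis using set_Bs by (intro exI[of _ Bs]) simp
qed

section \<open>The lower bound\<close>

definition pair :: "nat \<Rightarrow> nat set" where
  "pair n = {2 * n, 2 * n + 1}"

text \<open>For \<open>i < k\<close>, the residue modulo \<open>k\<close> of the regular index names
  the strand, and \<open>l\<close> counts jumps along it.\<close>

definition strand :: "nat \<Rightarrow> nat \<Rightarrow> nat set \<Rightarrow> nat set" where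
  "strand k i L = (\<Union>l\<in>L. pair (rho k (i + k * l)))"

text \<open>A column spans \<open>k\<close> periods of \<open>2 * k + 2\<close> positions, which
  amounts to \<open>2 * k + 1\<close> jumps on each strand. The rung at \<open>j * k + i\<close>
  with \<open>0 < i\<close> ties strand \<open>i\<close> to strand \<open>i - 1\<close>.\<close>

definition column :: "nat \<Rightarrow> nat \<Rightarrow> nat set" where
  "column k j = (\<Union>i\<in>{0..<k}. strand k i {j * (2 * k + 1)..<Suc j * (2 * k + 1)} \<union>
     (if i = 0 then {} else pair ((2 * k + 2) * (j * k + i))))"

definition block :: "nat \<Rightarrow> nat \<Rightarrow> nat set" where
  "block k b = {b * ((k + 2) * (2 * k + 1))..<Suc b * ((k + 2) * (2 * k + 1))}"

text \<open>Three blocks of \<open>k + 2\<close> columns each, with \<open>k\<close> multiples of \<open>2 * k + 2\<close> per column.\<close>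

definition G_size :: "nat \<Rightarrow> nat" where
  "G_size k = (2 * k + 2) * (3 * (k + 2) * k + 2)"

abbreviation G_linked :: "nat \<Rightarrow> nat set \<Rightarrow> bool" where
  "G_linked k \<equiv> linked (G_verts (G_size k)) (G_edges k (G_size k))"

abbreviation G_touch :: "nat \<Rightarrow> nat set \<Rightarrow> nat set \<Rightarrow> bool" where
  "G_touch k \<equiv> touch (G_edges k (G_size k))"

section \<open>Connectivity and disjointness of strands and columns\<close>

lemma G_edgeI: "arc k n m \<Longrightarrow> m < N \<Longrightarrow> {2 * n, 2 * m + 1} \<in> G_edges k N"
  unfolding G_edges_def by blast

lemma pair_iff: "v \<in> pair n \<longleftrightarrow> v div 2 = n"
  unfolding pair_def by auto

lemma pair_linked:
  assumes "n < N"
  shows "linked (G_verts N) (G_edges k N) (pair n)"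
proof -
  have "touch (G_edges k N) {2 * n} {2 * n + 1}"
    using G_edgeI[OF arc_vertical assms] unfolding touch_def by blast
  then have "linked (G_verts N) (G_edges k N) ({2 * n} \<union> {2 * n + 1})"
    using assms by (intro linked_Un linked_single) (auto simp: G_verts_def)
  then show ?thesis unfolding pair_def by (simp add: insert_commute)
qed

lemma strand_mono: "L \<subseteq> L' \<Longrightarrow> strand k i L \<subseteq> strand k i L'"
  unfolding strand_def by blast

lemma strand_iff: "v \<in> strand k i L \<longleftrightarrow> (\<exists>l\<in>L. v div 2 = rho k (i + k * l))"
  unfolding strand_def UN_iff pair_iff ..

lemma in_strand: "l \<in> L \<Longrightarrow> v div 2 = rho k (i + k * l) \<Longrightarrow> v \<in> strand k i L"
  unfolding strand_iff by blast

lemma strand_disjoint: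
  assumes "i < k" "i' < k" "i \<noteq> i' \<or> L \<inter> L' = {}"
  shows "strand k i L \<inter> strand k i' L' = {}"
proof (rule ccontr)
  assume "\<not> ?thesis"
  then obtain l l' where l: "l \<in> L" "l' \<in> L'" "rho k (i + k * l) = rho k (i' + k * l')"
    unfolding disjoint_iff strand_iff by metis
  then have eq: "i + k * l = i' + k * l'" using rho_eq_iff by blast
  have "i = i'" using arg_cong[OF eq, of "\<lambda>x. x mod k"] assms by simp
  moreover have "l = l'" using arg_cong[OF eq, of "\<lambda>x. x div k"] assms by simp
  ultimately show False using l assms by blast
qed

lemma strand_pair_disjoint: "strand k i L \<inter> pair ((2 * k + 2) * q) = {}"
  unfolding disjoint_iff strand_iff pair_iff using rho_neq_mult by metis

lemma rho_less_G_size: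
  assumes "i < k" "l < 3 * (k + 2) * (2 * k + 1)"
  shows "rho k (i + k * l) < G_size k"
proof -
  have "i + k * l < k * Suc l" using assms by simp
  also have "\<dots> \<le> k * (3 * (k + 2) * (2 * k + 1))" using assms by (intro mult_le_mono2) simp
  also have "\<dots> \<le> (2 * k + 1) * (3 * (k + 2) * k + 2)" by (simp add: algebra_simps)
  finally show ?thesis unfolding G_size_def rho_less_mult .
qed

lemma strand_linked:
  assumes "i < k" "a < b" "b \<le> 3 * (k + 2) * (2 * k + 1)"
  shows "G_linked k (strand k i {a..<b})"
  unfolding strand_def
proof (rule linked_chain[OF \<open>a < b\<close>])
  fix l assume "a \<le> l" "l < b"
  then show "G_linked k (pair (rho k (i + k * l)))"
    using assms by (intro pair_linked rho_less_G_size) auto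
next
  fix l assume l: "a \<le> l" "Suc l < b"
  have "rho k (i + k * Suc l) < G_size k"
    using assms l by (intro rho_less_G_size) auto
  moreover have "arc k (rho k (i + k * l)) (rho k (i + k * Suc l))"
    using arc_strand[of k "i + k * l"] by (simp add: ac_simps)
  ultimately show "G_touch k (pair (rho k (i + k * l))) (pair (rho k (i + k * Suc l)))"
    using G_edgeI unfolding touch_def pair_def by blast
qed

lemma rung_bound:
  assumes "j < 3 * (k + 2)" "i < k"
  shows "(2 * k + 2) * (j * k + i) + k < G_size k"
proof -
  have "j * k + i < Suc j * k" using assms by simp
  also have "\<dots> \<le> 3 * (k + 2) * k" using assms by (intro mult_le_mono1) simp
  finally have "(2 * k + 2) * (j * k + i) \<le> (2 * k + 2) * (3 * (k + 2) * k)"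
    by (intro mult_le_mono2) simp
  then show ?thesis unfolding G_size_def by (simp add: algebra_simps)
qed

text \<open>The rung at the multiple \<open>t\<close> leaves strand \<open>Suc i\<close> and joins strand \<open>i\<close>.\<close>

lemma rung_edges:
  assumes "j < 3 * (k + 2)" "Suc i < k"
  defines "t \<equiv> (2 * k + 2) * (j * k + Suc i)"
  shows "{2 * rho k (Suc i + k * (j * (2 * k + 1) + 2 * i + 1)), 2 * t + 1} \<in> G_edges k (G_size k)"
    and "{2 * t, 2 * rho k (i + k * (j * (2 * k + 1) + 2 * i + 3)) + 1} \<in> G_edges k (G_size k)"
proof -
  have t: "t + k < G_size k" using rung_bound assms unfolding t_def by blast
  have k: "0 < k" using assms by simp
  have q: "j * k + Suc i = Suc (j * k + i)" by simp
  \<comment> \<open>The index from \<open>rho_fork\<close> is split into a residue modulo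
    \<open>k\<close>, naming the strand, and a number of jumps; likewise below for
    \<open>rho_merge\<close>. The offsets \<open>2 * i + 1\<close> and \<open>2 * i + 3\<close> are
    less than \<open>2 * k + 1\<close>, so the rung attaches within column \<open>j\<close>.\<close>
  have "(2 * k + 1) * Suc (j * k + i) - k = Suc i + k * (j * (2 * k + 1) + 2 * i + 1)"
    by (simp add: algebra_simps)
  then have "arc k (rho k (Suc i + k * (j * (2 * k + 1) + 2 * i + 1))) t"
    using arc_fork[of k "j * k + i"] rho_fork[OF k, of "j * k + i"] unfolding t_def q by (simp only:)
  then show "{2 * rho k (Suc i + k * (j * (2 * k + 1) + 2 * i + 1)), 2 * t + 1} \<in> G_edges k (G_size k)"
    using t by (intro G_edgeI) auto
  have "(2 * k + 1) * Suc (j * k + i) + (k - 1) = i + k * (j * (2 * k + 1) + 2 * i + 3)"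
    using k by (cases k) (simp_all add: algebra_simps)
  then have "arc k t (rho k (i + k * (j * (2 * k + 1) + 2 * i + 3)))"
      "rho k (i + k * (j * (2 * k + 1) + 2 * i + 3)) = t + k"
    using arc_merge[of k "j * k + i"] rho_merge[OF k, of "Suc (j * k + i)"] unfolding t_def q by (simp_all only:)
  then show "{2 * t, 2 * rho k (i + k * (j * (2 * k + 1) + 2 * i + 3)) + 1} \<in> G_edges k (G_size k)"
    using t by (intro G_edgeI) auto
qed

text \<open>The strands are chained in the order of \<open>i\<close>: the rung in piece
  \<open>Suc i\<close> hangs on its own strand by the fork edge and reaches strand \<open>i\<close>
  by the merge edge.\<close>

lemma column_linked:
  assumes "0 < k" and j: "j < 3 * (k + 2)"
  shows "G_linked k (column k j)"
proof -
  let ?L = "{j * (2 * k + 1)..<Suc j * (2 * k + 1)}"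
  let ?R = "\<lambda>i. if i = 0 then {} else pair ((2 * k + 2) * (j * k + i))"
  have "Suc j * (2 * k + 1) \<le> 3 * (k + 2) * (2 * k + 1)" using j by (intro mult_le_mono1) simp
  then have S: "G_linked k (strand k i ?L)" if "i < k" for i
    using that by (intro strand_linked) auto
  show ?thesis unfolding column_def
  proof (rule linked_chain[OF \<open>0 < k\<close>])
    fix i assume i: "i < k"
    show "G_linked k (strand k i ?L \<union> ?R i)"
    proof (cases i)
      case 0
      then show ?thesis using S[OF i] by simp
    next
      case (Suc i')
      let ?l = "j * (2 * k + 1) + 2 * i' + 1"
      have "2 * rho k (i + k * ?l) \<in> strand k i ?L"
        using i Suc by (intro in_strand[of ?l]) auto
      then have "G_touch k (strand k i ?L) (pair ((2 * k + 2) * (j * k + i)))"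
        using rung_edges(1)[OF j, of i'] i unfolding Suc touch_def pair_def by blast
      moreover have "G_linked k (pair ((2 * k + 2) * (j * k + i)))"
        using rung_bound[OF j i] by (intro pair_linked) simp
      ultimately show ?thesis using linked_Un[OF S[OF i]] Suc by simp
    qed
  next
    fix i assume i: "Suc i < k"
    let ?l = "j * (2 * k + 1) + 2 * i + 3"
    have "2 * rho k (i + k * ?l) + 1 \<in> strand k i ?L"
      using i by (intro in_strand[of ?l]) auto
    then have "G_touch k (strand k i ?L) (pair ((2 * k + 2) * (j * k + Suc i)))"
      by (rule touch_edge) (use rung_edges(2)[OF j i] in \<open>auto simp: pair_def insert_commute\<close>)
    then show "G_touch k (strand k i ?L \<union> ?R i) (strand k (Suc i) ?L \<union> ?R (Suc i))"
      by (rule touch_mono) auto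
  qed
qed

text \<open>A column stays within its own stretch of \<open>k\<close> periods, so the position of a
  vertex reveals its column; distinct columns are therefore disjoint.\<close>

lemma column_disjoint:
  assumes "v \<in> column k j"
  shows "v div 2 div ((2 * k + 2) * k) = j"
proof -
  obtain i where i: "i < k" and v: "v \<in> strand k i {j * (2 * k + 1)..<Suc j * (2 * k + 1)} \<union>
     (if i = 0 then {} else pair ((2 * k + 2) * (j * k + i)))"
    using assms unfolding column_def by auto
  have "(2 * k + 2) * (j * k) \<le> v div 2 \<and> v div 2 < (2 * k + 2) * (Suc j * k)"
  proof (cases "v \<in> strand k i {j * (2 * k + 1)..<Suc j * (2 * k + 1)}")
    case True
    then obtain l where l: "j * (2 * k + 1) \<le> l" "Suc l \<le> Suc j * (2 * k + 1)" "v div 2 = rho k (i + k * l)"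
      unfolding strand_iff by (auto simp: Suc_le_eq)
    have "k * (j * (2 * k + 1)) \<le> k * l" "k * Suc l \<le> k * (Suc j * (2 * k + 1))"
      using l by (intro mult_le_mono2; simp)+
    then have "\<not> i + k * l < (2 * k + 1) * (j * k)" "i + k * l < (2 * k + 1) * (Suc j * k)"
      using i by (simp_all add: algebra_simps)
    then show ?thesis using l(3) rho_less_mult[of k "i + k * l"] by (metis not_le)
  next
    case False
    then have "v div 2 = (2 * k + 2) * (j * k + i)"
      using v by (auto simp: pair_iff split: if_splits)
    moreover have "(2 * k + 2) * (j * k + i) < (2 * k + 2) * (Suc j * k)"
      using i by (intro mult_less_mono2) auto
    moreover have "(2 * k + 2) * (j * k) \<le> (2 * k + 2) * (j * k + i)"
      by (intro mult_le_mono2) simp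
    ultimately show ?thesis by simp
  qed
  then show ?thesis by (intro div_nat_eqI) (simp_all add: algebra_simps)
qed

lemma block_bound: "b < 3 \<Longrightarrow> Suc b * ((k + 2) * (2 * k + 1)) \<le> 3 * (k + 2) * (2 * k + 1)"
  by (metis Suc_leI mult.assoc mult_le_mono1)

text \<open>Each union of a strand and a column meets each other such union, so a common bag exists;
  it cannot meet all of the \<open>k + 2\<close> disjoint columns.\<close>

lemma block_bag:
  assumes pd: "path_decomposition (G_verts (G_size k)) (G_edges k (G_size k)) Bs"
    and small: "\<And>B. B \<in> set Bs \<Longrightarrow> card B \<le> k + 1"
    and "0 < k" and b: "b < 3"
  shows "\<exists>\<beta><length Bs. \<forall>i<k. Bs ! \<beta> \<inter> strand k i (block k b) \<noteq> {}"
proof -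
  define J where "J = {b * (k + 2)..<Suc b * (k + 2)}"
  let ?L = "\<lambda>j. {j * (2 * k + 1)..<Suc j * (2 * k + 1)}"
  define F where "F = (\<lambda>(i, j). strand k i (block k b) \<union> column k j)"
  have J: "j < 3 * (k + 2)" "?L j \<subseteq> block k b" if "j \<in> J" for j
  proof -
    have "Suc b * (k + 2) \<le> 3 * (k + 2)" using b by (intro mult_le_mono1) simp
    then show "j < 3 * (k + 2)" using that unfolding J_def by simp
    have "b * (k + 2) * (2 * k + 1) \<le> j * (2 * k + 1)" "Suc j * (2 * k + 1) \<le> Suc b * (k + 2) * (2 * k + 1)"
      using that unfolding J_def by (intro mult_le_mono1; simp)+
    then show "?L j \<subseteq> block k b"
      unfolding block_def mult.assoc by (intro ivl_subset[THEN iffD2]) simp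
  qed
  have SC: "strand k i (?L j) \<subseteq> column k j" if "i < k" for i j
    using that unfolding column_def by auto
  have meet: "\<exists>v. v \<in> strand k i (block k b) \<and> v \<in> column k j" if "i < k" "j \<in> J" for i j
  proof -
    have "2 * rho k (i + k * (j * (2 * k + 1))) \<in> strand k i (?L j)"
      by (rule in_strand[of "j * (2 * k + 1)"]) auto
    then show ?thesis using SC[OF that(1)] strand_mono[OF J(2)[OF that(2)]] by blast
  qed
  have "\<exists>\<beta><length Bs. \<forall>p\<in>{..<k} \<times> J. Bs ! \<beta> \<inter> F p \<noteq> {}"
  proof (rule common_bag[OF pd])
    show "finite ({..<k} \<times> J)" "{..<k} \<times> J \<noteq> {}" using \<open>0 < k\<close> unfolding J_def by auto
  next
    fix p assume "p \<in> {..<k} \<times> J"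
    then obtain i j where p: "p = (i, j)" "i < k" "j \<in> J" by auto
    have "G_linked k (strand k i (block k b))"
      unfolding block_def using p(2) block_bound[OF b] by (intro strand_linked) auto
    moreover have "G_touch k (strand k i (block k b)) (column k j)"
      using meet[OF p(2,3)] touch_common by metis
    ultimately show "G_linked k (F p)"
      using column_linked[OF \<open>0 < k\<close> J(1)[OF p(3)]] unfolding F_def p by (simp add: linked_Un)
  next
    fix p p' assume "p \<in> {..<k} \<times> J" "p' \<in> {..<k} \<times> J"
    then obtain i j i' j' where p: "p = (i, j)" "i < k" "p' = (i', j')" "j' \<in> J" by auto
    then obtain v where "v \<in> strand k i (block k b)" "v \<in> column k j'" using meet by blast
    then have "v \<in> F p" "v \<in> F p'" unfolding F_def p by auto
    then show "G_touch k (F p) (F p')" by (rule touch_common)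
  qed
  then obtain \<beta> where \<beta>: "\<beta> < length Bs" "\<And>i j. i < k \<Longrightarrow> j \<in> J \<Longrightarrow> Bs ! \<beta> \<inter> F (i, j) \<noteq> {}"
    by blast
  have "Bs ! \<beta> \<inter> strand k i (block k b) \<noteq> {}" if i: "i < k" for i
  proof
    assume "Bs ! \<beta> \<inter> strand k i (block k b) = {}"
    \<comment> \<open>If strand \<open>i\<close> is avoided, each \<open>F (i, j)\<close> can be met
      only inside its column.\<close>
    then have "Bs ! \<beta> \<inter> column k j \<noteq> {}" if "j \<in> J" for j
      using \<beta>(2)[OF i that] unfolding F_def by auto
    moreover have "disjoint_family_on (column k) J"
      using column_disjoint unfolding disjoint_family_on_def by blast
    moreover have "finite (Bs ! \<beta>)"
      using finite_bag[OF pd _ \<beta>(1)] unfolding G_verts_def by simp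
    ultimately have "card J \<le> card (Bs ! \<beta>)"
      unfolding J_def by (intro card_hit_disjoint) auto
    moreover have "card J = k + 2" unfolding J_def by simp
    ultimately show False using small[OF nth_mem[OF \<beta>(1)]] by simp
  qed
  then show ?thesis using \<beta>(1) by blast
qed

text \<open>With \<open>2 \<le> k\<close>, strands 0 and 1 are distinct, so the rung between them
  can be split into two halves.\<close>

lemma G_large_bag_ge2:
  assumes pd: "path_decomposition (G_verts (G_size k)) (G_edges k (G_size k)) Bs" and k: "2 \<le> k"
  shows "\<exists>B\<in>set Bs. k + 2 \<le> card B"
proof (rule ccontr)
  assume "\<not> ?thesis"
  then have small: "card B \<le> k + 1" if "B \<in> set Bs" for B using that by fastforce
  \<comment> \<open>Every case ends here: \<open>k\<close> disjoint sets together with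
    \<open>U\<close> and \<open>W\<close> make \<open>k + 2\<close> disjoint sets met by one
    bag.\<close>
  have big: False
    if j: "j < length Bs" and FP: "\<And>i. i < k \<Longrightarrow> F i \<inter> Bs ! j \<noteq> {}"
      and U: "U \<inter> Bs ! j \<noteq> {}" and W: "W \<inter> Bs ! j \<noteq> {}"
      and disj: "\<And>i i'. i < k \<Longrightarrow> i' < k \<Longrightarrow> i \<noteq> i' \<Longrightarrow> F i \<inter> F i' = {}"
        "\<And>i. i < k \<Longrightarrow> F i \<inter> (U \<union> W) = {}" "U \<inter> W = {}" for j F U W
  proof -
    define H where "H i = (if i < k then F i else if i = k then U else W)" for i
    have "disjoint_family_on H {..<k + 2}"
      unfolding disjoint_family_on_def
    proof (intro ballI impI)
      fix i i' assume "i \<in> {..<k + 2}" "i' \<in> {..<k + 2}" "i \<noteq> i'"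
      then consider "i < k" "i' < k" | "i < k" "i' \<ge> k" | "i \<ge> k" "i' < k" | "i = k" "i' = k + 1" | "i = k + 1" "i' = k"
        by fastforce
      then show "H i \<inter> H i' = {}"
        using disj(1)[of i i'] disj(2)[of i] disj(2)[of i'] disj(3) \<open>i \<noteq> i'\<close>
        by cases (auto simp: H_def)
    qed
    moreover have "Bs ! j \<inter> H i \<noteq> {}" for i using FP U W unfolding H_def by (auto simp: Int_commute)
    moreover have "finite (Bs ! j)" using finite_bag[OF pd _ j] unfolding G_verts_def by simp
    ultimately have "card {..<k + 2} \<le> card (Bs ! j)" by (intro card_hit_disjoint) auto
    then show False using small[OF nth_mem[OF j]] by simp
  qed
  have "\<exists>\<beta><length Bs. \<forall>i<k. Bs ! \<beta> \<inter> strand k i (block k b) \<noteq> {}" if "b < 3" for b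
    using block_bag[OF pd small _ that] k by simp
  then obtain \<beta> where \<beta>: "\<And>b. b < 3 \<Longrightarrow> \<beta> b < length Bs"
      "\<And>b i. b < 3 \<Longrightarrow> i < k \<Longrightarrow> Bs ! \<beta> b \<inter> strand k i (block k b) \<noteq> {}"
    by metis
  \<comment> \<open>Sorting the three bag indices lets \<open>b\<close> name the block whose bag is
    the middle one.\<close>
  have "\<exists>a b c. a < 3 \<and> b < 3 \<and> c < (3::nat) \<and> a \<noteq> b \<and> b \<noteq> c \<and> \<beta> a \<le> \<beta> b \<and> \<beta> b \<le> \<beta> c"
    (is "\<exists>a b c. ?P a b c")
  proof -
    have "?P 0 1 2 \<or> ?P 0 2 1 \<or> ?P 1 0 2 \<or> ?P 1 2 0 \<or> ?P 2 0 1 \<or> ?P 2 1 0"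
      by simp linarith
    then show ?thesis by (elim disjE; intro exI)
  qed
  then obtain a b c where abc: "a < 3" "b < 3" "c < 3" "a \<noteq> b" "b \<noteq> c" "\<beta> a \<le> \<beta> b" "\<beta> b \<le> \<beta> c"
    by blast
  \<comment> \<open>\<open>j\<close> is the first column of block \<open>b\<close>, and
    \<open>t\<close> is the position of its rung between strands 1 and 0. The lower end
    \<open>2 * t + 1\<close> of the middle edge extends strand 1 to \<open>U\<close>, the upper end
    \<open>2 * t\<close> extends strand 0 to \<open>W\<close>.\<close>
  define j where "j = b * (k + 2)"
  define q where "q = j * k + 1"
  define t where "t = (2 * k + 2) * q"
  define U where "U = strand k 1 (block k b) \<union> {2 * t + 1}"
  define W where "W = strand k 0 (block k b) \<union> {2 * t}"
  have "Suc b * (k + 2) \<le> 3 * (k + 2)" using abc by (intro mult_le_mono1) simp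
  then have j: "j < 3 * (k + 2)" unfolding j_def by simp
  have t: "t < G_size k" using rung_bound[OF j, of 1] k unfolding t_def q_def by simp
  have e: "{2 * rho k (1 + k * (j * (2 * k + 1) + 1)), 2 * t + 1} \<in> G_edges k (G_size k)"
     "{2 * t, 2 * rho k (0 + k * (j * (2 * k + 1) + 3)) + 1} \<in> G_edges k (G_size k)"
    using rung_edges[OF j, of 0] k unfolding t_def q_def by simp_all
  have tpair: "2 * t \<in> pair ((2 * k + 2) * q)" "2 * t + 1 \<in> pair ((2 * k + 2) * q)"
    unfolding t_def pair_def by simp_all
  have off: "2 * t \<notin> strand k i L" "2 * t + 1 \<notin> strand k i L" for i L
    using strand_pair_disjoint[of k i L q] tpair by blast+
  have block_linked: "G_linked k (strand k i (block k b'))" if "b' < 3" "i < k" for b' i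
    unfolding block_def using that block_bound[OF that(1)] by (intro strand_linked) auto
  have in_block: "j * (2 * k + 1) + 1 \<in> block k b" "j * (2 * k + 1) + 3 \<in> block k b"
    using k unfolding block_def j_def by (auto simp: algebra_simps)
  have "2 * rho k (1 + k * (j * (2 * k + 1) + 1)) \<in> strand k 1 (block k b)"
    by (rule in_strand[OF in_block(1)]) simp
  then have "G_touch k (strand k 1 (block k b)) {2 * t + 1}" using e(1) unfolding touch_def by blast
  then have U_linked: "G_linked k U"
    unfolding U_def using block_linked[OF abc(2), of 1] k t
    by (intro linked_Un linked_single) (auto simp: G_verts_def)
  have "2 * rho k (0 + k * (j * (2 * k + 1) + 3)) + 1 \<in> strand k 0 (block k b)"
    by (rule in_strand[OF in_block(2)]) simp
  then have "G_touch k (strand k 0 (block k b)) {2 * t}"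
    by (rule touch_edge) (use e(2) in \<open>auto simp: insert_commute\<close>)
  then have W_linked: "G_linked k W"
    unfolding W_def using block_linked[OF abc(2), of 0] k t
    by (intro linked_Un linked_single) (auto simp: G_verts_def)
  have "{2 * t, 2 * t + 1} \<in> G_edges k (G_size k)" using G_edgeI[OF arc_vertical t] .
  then obtain \<gamma> where \<gamma>: "\<gamma> < length Bs" "2 * t \<in> Bs ! \<gamma>" "2 * t + 1 \<in> Bs ! \<gamma>"
    using path_decomposition_edge[OF pd] by (metis in_set_conv_nth)
  text \<open>A block on the far side of \<open>\<gamma>\<close> is passed by both \<open>U\<close> and \<open>W\<close>.\<close>
  have far: False if d: "d < 3" "d \<noteq> b"
    and btw: "\<beta> b \<le> \<beta> d \<and> \<beta> d \<le> \<gamma> \<or> \<gamma> \<le> \<beta> d \<and> \<beta> d \<le> \<beta> b" for d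
  proof (rule big[OF \<beta>(1)[OF d(1)], of "\<lambda>i. strand k i (block k d)" U W])
    have "\<beta> b \<in> hits Bs U" "\<beta> b \<in> hits Bs W" "\<gamma> \<in> hits Bs U" "\<gamma> \<in> hits Bs W"
      using \<beta>[OF abc(2)] \<gamma> k unfolding hits_def U_def W_def by auto
    then have "\<beta> d \<in> hits Bs U" "\<beta> d \<in> hits Bs W"
      using btw gaplessD[OF linked_gapless[OF pd U_linked]] gaplessD[OF linked_gapless[OF pd W_linked]]
      by blast+
    then show "U \<inter> Bs ! \<beta> d \<noteq> {}" "W \<inter> Bs ! \<beta> d \<noteq> {}" unfolding hits_def by auto
    show "strand k i (block k d) \<inter> Bs ! \<beta> d \<noteq> {}" if "i < k" for i
      using \<beta>(2)[OF d(1) that] by (simp add: Int_commute)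
    show "strand k i (block k d) \<inter> strand k i' (block k d) = {}" if "i < k" "i' < k" "i \<noteq> i'" for i i'
      using that by (intro strand_disjoint) auto
    have "block k d \<inter> block k b = {}"
    proof -
      have "l div ((k + 2) * (2 * k + 1)) = b'" if "l \<in> block k b'" for l b'
        using that unfolding block_def by (intro div_nat_eqI) (auto simp: ac_simps)
      then show ?thesis using d(2) by blast
    qed
    then show "strand k i (block k d) \<inter> (U \<union> W) = {}" if "i < k" for i
      using strand_disjoint[of i k 0 "block k d" "block k b"] strand_disjoint[of i k 1 "block k d" "block k b"]
        off that k unfolding U_def W_def by auto
    show "U \<inter> W = {}"
      using strand_disjoint[of 1 k 0 "block k b" "block k b"] off k unfolding U_def W_def by auto
  qed
  show False
  proof (cases "\<beta> a \<le> \<gamma> \<and> \<gamma> \<le> \<beta> c")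
    case True
    \<comment> \<open>These are strands through all three blocks. Each is connected and meets the
      bags at \<open>\<beta> a\<close> and \<open>\<beta> c\<close>, hence also the one at
      \<open>\<gamma>\<close>; the ends of the middle edge lie on no strand.\<close>
    let ?P = "\<lambda>i. strand k i {0..<3 * (k + 2) * (2 * k + 1)}"
    show False
    proof (rule big[OF \<gamma>(1), of ?P "{2 * t}" "{2 * t + 1}"])
      fix i assume i: "i < k"
      have "block k d \<subseteq> {0..<3 * (k + 2) * (2 * k + 1)}" if "d < 3" for d
        using block_bound[OF that, of k] unfolding block_def by auto
      then have "\<beta> d \<in> hits Bs (?P i)" if "d < 3" for d
        using \<beta>[OF that] i strand_mono[of "block k d" _ k i] that unfolding hits_def by blast
      moreover have "G_linked k (?P i)" using i by (intro strand_linked) auto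
      ultimately have "\<gamma> \<in> hits Bs (?P i)"
        using True gaplessD[OF linked_gapless[OF pd]] abc by blast
      then show "?P i \<inter> Bs ! \<gamma> \<noteq> {}" unfolding hits_def by auto
    next
      show "?P i \<inter> ?P i' = {}" if "i < k" "i' < k" "i \<noteq> i'" for i i'
        using that by (intro strand_disjoint) auto
    qed (use off \<gamma> in auto)
  next
    case False
    \<comment> \<open>If \<open>\<gamma>\<close> precedes \<open>\<beta> a\<close> or follows
      \<open>\<beta> c\<close>, that outer bag lies between \<open>\<gamma>\<close> and
      \<open>\<beta> b\<close>.\<close>
    then show False using far[of a] far[of c] abc by linarith
  qed
qed

text \<open>For \<open>k \<le> 1\<close> there are no two strands to join, so a clique minor
  replaces the block argument: a single edge for \<open>k = 0\<close>, a triangle for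
  \<open>k = 1\<close>.\<close>

lemma G_large_bag:
  assumes pd: "path_decomposition (G_verts (G_size k)) (G_edges k (G_size k)) Bs"
  shows "\<exists>B\<in>set Bs. k + 2 \<le> card B"
proof -
  have fin: "finite (G_verts N)" for N unfolding G_verts_def by simp
  consider "k = 0" | "k = 1" | "2 \<le> k" by linarith
  then show ?thesis
  proof cases
    case 1
    have "{0, 1} \<in> G_edges k (G_size k)"
      using G_edgeI[OF arc_vertical, of 0] unfolding G_size_def by simp
    then have "G_touch k {0} {1}" unfolding touch_def by blast
    then have touch: "G_touch k {i} {j}" if "i < 2" "j < 2" for i j
      using that touch_sym unfolding less_2_cases_iff by (auto intro: touch_common)
    have "\<exists>B\<in>set Bs. card {..<2::nat} \<le> card B"
    proof (rule clique_minor_bag[OF pd fin, of _ "\<lambda>i. {i}"])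
      show "linked (G_verts (G_size k)) (G_edges k (G_size k)) {i}" if "i \<in> {..<2}" for i
        using that by (intro linked_single) (simp add: G_verts_def G_size_def)
    qed (use touch in \<open>auto simp: disjoint_family_on_def lessThan_empty_iff\<close>)
    then show ?thesis using 1 by (simp add: numeral_2_eq_2)
  next
    case 2
    text \<open>The 4-cycle \<open>6, 9, 8, 11\<close> contracts to a triangle.\<close>
    have size: "G_size k = 44" using 2 unfolding G_size_def by simp
    have "arc k 3 4" "arc k 4 5" "arc k 3 5"
      using arc_fork[of k 0] arc_merge[of k 0] arc_strand[of k 2] 2 by (simp_all add: rho_def)
    then have E: "{6, 9} \<in> G_edges k (G_size k)" "{8, 11} \<in> G_edges k (G_size k)"
      "{6, 11} \<in> G_edges k (G_size k)"
      using G_edgeI[of k _ _ "G_size k"] size by fastforce+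
    define F :: "nat \<Rightarrow> nat set" where "F i = (if i = 0 then {6} else if i = 1 then pair 4 else {11})" for i
    have "G_touch k (F 0) (F 1)" "G_touch k (F 0) (F 2)" "G_touch k (F 1) (F 2)"
      using E unfolding touch_def F_def pair_def by auto
    moreover have "G_touch k (F i) (F i)" for i
      unfolding F_def pair_def by (auto intro: touch_common)
    ultimately have touch: "G_touch k (F i) (F j)" if "i < 3" "j < 3" for i j
      using that touch_sym by (auto simp: numeral_3_eq_3 less_Suc_eq numeral_2_eq_2)
    have "\<exists>B\<in>set Bs. card {..<3::nat} \<le> card B"
    proof (rule clique_minor_bag[OF pd fin, of _ F])
      show "linked (G_verts (G_size k)) (G_edges k (G_size k)) (F i)" for i
        unfolding F_def using pair_linked[of 4 "G_size k" k] size
        by (auto intro!: linked_single simp: G_verts_def)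
    qed (use touch in \<open>auto simp: disjoint_family_on_def lessThan_empty_iff F_def pair_def\<close>)
    then show ?thesis using 2 by (simp add: numeral_3_eq_3)
  qed (rule G_large_bag_ge2[OF pd])
qed

theorem theorem3:
  "\<forall>k::nat. \<exists>(V::nat set) E. fin_graph V E \<and> two_layer_k_planar k V E \<and> pathwidth V E = int k + 1"
proof
  fix k :: nat
  let ?V = "G_verts (G_size k)" and ?E = "G_edges k (G_size k)"
  have "0 < G_size k" unfolding G_size_def by simp
  then obtain Bs where "path_decomposition ?V ?E Bs" "\<forall>B\<in>set Bs. card B \<le> k + 2"
    using path_decomposition_G by blast
  then have "pathwidth ?V ?E = int (Suc k)"
    using G_large_bag by (intro pathwidth_eqI[of ?V ?E Bs]) auto
  then show "\<exists>(V::nat set) E. fin_graph V E \<and> two_layer_k_planar k V E \<and> pathwidth V E = int k + 1"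
    using fin_graph_G two_layer_k_planar_G by (intro exI[of _ ?V] exI[of _ ?E]) auto
qed

end
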